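(* Let $(\mathcal{B},\mu)$ be a strictly positive atomless normalized measure algebra, and let $W_3(x,y,z)=(x+y+z-2)^+$ for $(x,y,z)\in[0,1]^3$. There do not exist three increasing event chains $(A_x)_{x\in[0,1]}$, $(B_y)_{y\in[0,1]}$, $(C_z)_{z\in[0,1]}$ in $\mathcal{B}$ with $\mu(A_x)=x$, $\mu(B_y)=y$, $\mu(C_z)=z$ and $$\mu(A_x\wedge B_y\wedge C_z)=W_3(x,y,z)$$ simultaneously for all $(x,y,z)\in[0,1]^3$.
   Context: A strictly positive atomless normalized measure algebra $(\mathcal{B},\mu)$ is a Dedekind $\sigma$-complete Boolean algebra $\mathcal{B}$ with a countably additive $\mu:\mathcal{B}\to[0,1]$ such that $\mu(1)=1$, $\mu(a)>0$ for every $a\neq 0$, and $\mathcal{B}$ has no atoms. An increasing event chain is a family $(A_x)_{x\in[0,1]}$ in $\mathcal{B}$ with $A_x\le A_{x'}$ whenever $x\le x'$. Here $t^+=\max\{t,0\}$. *)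

theory Defs
  imports Complex_Main "HOL-Library.Countable_Complete_Lattices"
begin

(* Sup and Inf are only axiomatised on countable sets, so this is exactly
   Dedekind sigma-completeness; uncountable suprema need not exist. *)
class sigma_complete_boolean_algebra = boolean_algebra + countable_complete_lattice

definition is_atom :: "'a::boolean_algebra \<Rightarrow> bool" where
  "is_atom a \<longleftrightarrow> a \<noteq> bot \<and> (\<forall>b. b \<le> a \<longrightarrow> b = bot \<or> b = a)"

locale strictly_positive_atomless_normalized_measure_algebra =
  fixes \<mu> :: "'a::sigma_complete_boolean_algebra \<Rightarrow> real"
  assumes measure_range: "\<mu> a \<in> {0..1}"
    and countably_additive:
      "(\<And>m n. m \<noteq> n \<Longrightarrow> inf (e m) (e n) = bot) \<Longrightarrow> (\<lambda>n::nat. \<mu> (e n)) sums \<mu> (SUP n. e n)"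
    and normalized: "\<mu> top = 1"
    and strictly_positive: "a \<noteq> bot \<Longrightarrow> \<mu> a > 0"
    and atomless: "\<not> is_atom a"

(* The family is indexed by [0,1]; values of A outside [0,1] are irrelevant. *)
definition increasing_event_chain :: "(real \<Rightarrow> 'a::boolean_algebra) \<Rightarrow> bool" where
  "increasing_event_chain A \<longleftrightarrow> mono_on {0..1} A"

definition W3 :: "real \<Rightarrow> real \<Rightarrow> real \<Rightarrow> real" where
  "W3 x y z = max (x + y + z - 2) 0"

end

(* The three chains at 1/2 would be three pairwise disjoint events of measure 1/2:
   W3 vanishes at (1/2, 1/2, 1) and its permutations, strict positivity turns measure zero
   into bot and measure one into top. Their measures would add up to 3/2 > 1. *)

theory Submission
  imports Defs
begin

context strictly_positive_atomless_normalized_measure_algebra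
begin

text \<open>Additivity is given only for sequences, so the triple is padded with \<open>bot\<close>,
  which is disjoint from every element, itself included. The total mass of the sequence is the
  measure of its supremum, hence at most 1.\<close>

lemma disjoint_triple_measure_le_1:
  assumes "inf a b = bot" "inf a c = bot" "inf b c = bot"
  shows "\<mu> a + \<mu> b + \<mu> c \<le> 1"
proof -
  define e :: "nat \<Rightarrow> 'a"
    where "e n = (if n = 0 then a else if n = 1 then b else if n = 2 then c else bot)" for n
  have sums: "(\<lambda>n. \<mu> (e n)) sums \<mu> (SUP n. e n)"
    by (rule countably_additive) (use assms in \<open>auto simp: e_def inf_commute\<close>)
  \<comment> \<open>The terms are nonnegative, so cutting off the tail can only lower the sum,
    whatever the value of \<open>\<mu> bot\<close>.\<close>
  have "(\<Sum>n<3. \<mu> (e n)) \<le> (\<Sum>n. \<mu> (e n))"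
    by (rule sum_le_suminf) (use sums measure_range in \<open>auto simp: sums_iff\<close>)
  also have "\<dots> \<le> 1"
    using sums measure_range[of "SUP n. e n"] by (auto simp: sums_iff)
  finally show ?thesis
    by (simp add: e_def numeral_3_eq_3)
qed

lemma measure_eq_0_imp_bot: "\<mu> a = 0 \<Longrightarrow> a = bot"
  using strictly_positive[of a] by auto

lemma measure_eq_1_imp_top:
  assumes "\<mu> a = 1"
  shows "a = top"
proof -
  \<comment> \<open>With \<open>bot\<close> as third member of the triple, the bound leaves no mass
    for the complement of \<open>a\<close>.\<close>
  have "\<mu> (- a) = 0"
    using disjoint_triple_measure_le_1[of a "- a" bot] assms
      measure_range[of "- a"] measure_range[of bot] by simp
  then show ?thesis
    using measure_eq_0_imp_bot[of "- a"] double_compl[of a] by simp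
qed

end

theorem proposition13:
  fixes \<mu> :: "'a::sigma_complete_boolean_algebra \<Rightarrow> real"
  assumes "strictly_positive_atomless_normalized_measure_algebra \<mu>"
  shows "\<not> (\<exists>A B C :: real \<Rightarrow> 'a.
    increasing_event_chain A \<and> increasing_event_chain B \<and> increasing_event_chain C \<and>
    (\<forall>x\<in>{0..1}. \<mu> (A x) = x) \<and> (\<forall>y\<in>{0..1}. \<mu> (B y) = y) \<and> (\<forall>z\<in>{0..1}. \<mu> (C z) = z) \<and>
    (\<forall>x\<in>{0..1}. \<forall>y\<in>{0..1}. \<forall>z\<in>{0..1}. \<mu> (inf (inf (A x) (B y)) (C z)) = W3 x y z))"
proof (intro notI, elim exE conjE)
  interpret strictly_positive_atomless_normalized_measure_algebra \<mu> by fact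
  fix A B C :: "real \<Rightarrow> 'a"
  assume A: "\<forall>x\<in>{0..1}. \<mu> (A x) = x" and B: "\<forall>y\<in>{0..1}. \<mu> (B y) = y"
    and C: "\<forall>z\<in>{0..1}. \<mu> (C z) = z"
    and W: "\<forall>x\<in>{0..1}. \<forall>y\<in>{0..1}. \<forall>z\<in>{0..1}. \<mu> (inf (inf (A x) (B y)) (C z)) = W3 x y z"
  \<comment> \<open>Setting one index to 1 now removes that factor from the triple meet, so
    \<open>W\<close> speaks about pairwise meets.\<close>
  have top: "A 1 = top" "B 1 = top" "C 1 = top"
    using A B C by (auto intro!: measure_eq_1_imp_top)
  have "\<mu> (inf (A (1/2)) (B (1/2))) = 0"
    using W[rule_format, of "1/2" "1/2" 1] top by (simp add: W3_def)
  moreover have "\<mu> (inf (A (1/2)) (C (1/2))) = 0"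
    using W[rule_format, of "1/2" 1 "1/2"] top by (simp add: W3_def)
  moreover have "\<mu> (inf (B (1/2)) (C (1/2))) = 0"
    using W[rule_format, of 1 "1/2" "1/2"] top by (simp add: W3_def)
  ultimately have "\<mu> (A (1/2)) + \<mu> (B (1/2)) + \<mu> (C (1/2)) \<le> 1"
    by (intro disjoint_triple_measure_le_1 measure_eq_0_imp_bot)
  then show False
    using A B C by simp
qed

end
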